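(* Let $\mathbb F\in\{\mathbb R,\mathbb C\}$, let $X$ be a Banach space over $\mathbb F$, and let $L$ be an extremally disconnected compact Hausdorff space such that $\operatorname{dens}(X)<\kappa(L)$. Then $(X,C(L,\mathbb F))$ has the Bishop--Phelps--Bollobás property with modulus $\eta(\varepsilon)=\varepsilon^2/32$; that is, for every $\varepsilon\in(0,1)$, whenever $T\in S_{\mathcal L(X,C(L,\mathbb F))}$ and $x_0\in S_X$ satisfy $\|Tx_0\|>1-\varepsilon^2/32$, there exist $S\in S_{\mathcal L(X,C(L,\mathbb F))}$ and $u_0\in S_X$ such that $\|Su_0\|=1$, $\|u_0-x_0\|<\varepsilon$ and $\|S-T\|<\varepsilon$.
   Context: $C(L,\mathbb F)$ is the Banach space of continuous $\mathbb F$-valued functions on $L$ with the supremum norm. A compact Hausdorff space is extremally disconnected if the closure of every open subset is open. $\operatorname{dens}(X)$ is the density character of $X$: the least cardinality of a norm-dense subset of $X$. The Baire number $\kappa(L)$ of a topological space $L$ is the least cardinal $\kappa$ for which there exists a family of $\kappa$ dense open subsets of $L$ whose intersection is not dense in $L$; if no such family exists, $\kappa(L)=\infty$ (larger than every cardinal). For a Banach space $Z$, $S_Z$ is its unit sphere; $\mathcal L(X,Y)$ is the space of bounded linear operators from $X$ to $Y$ with the operator norm. *)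

theory Defs
  imports "HOL-Analysis.Analysis"
begin

unbundle cardinal_syntax

section \<open>Density character and Baire number\<close>

text \<open>Cardinals are represented, as in the library, by the well-orders \<open>|A|\<close>. In both definitions
  below the choice operator picks a witness of least cardinality. Different choices give
  isomorphic orders, so the choice does not matter for comparisons with \<open><o\<close> and \<open>\<le>o\<close>.\<close>

definition dense :: "'a::topological_space set \<Rightarrow> bool" where
  "dense D \<longleftrightarrow> closure D = UNIV"

definition has_least_card :: "('a set \<Rightarrow> bool) \<Rightarrow> 'a set \<Rightarrow> bool" where
  "has_least_card P A \<longleftrightarrow> P A \<and> (\<forall>B. P B \<longrightarrow> |A| \<le>o |B| )"

definition dens :: "'x::topological_space itself \<Rightarrow> 'x rel" where
  "dens _ = |SOME D. has_least_card dense D|"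

definition non_baire_family :: "'l::topological_space set set \<Rightarrow> bool" where
  "non_baire_family \<G> \<longleftrightarrow> (\<forall>G\<in>\<G>. open G \<and> dense G) \<and> \<not> dense (\<Inter>\<G>)"

text \<open>\<open>None\<close> stands for the value \<open>\<infinity>\<close>.\<close>

definition baire_number :: "'l::topological_space itself \<Rightarrow> 'l set rel option" where
  "baire_number _ =
     (if \<exists>\<G> :: 'l set set. non_baire_family \<G>
      then Some |SOME \<G> :: 'l set set. has_least_card non_baire_family \<G>|
      else None)"

definition less_card_infty :: "'a rel \<Rightarrow> 'b rel option \<Rightarrow> bool" where
  "less_card_infty r k \<longleftrightarrow> (case k of None \<Rightarrow> True | Some s \<Rightarrow> r <o s)"

lemma has_least_card_ex:
  assumes "P A"
  shows "\<exists>A. has_least_card P A"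
proof -
  let ?R = "card_of ` Collect P"
  have "?R \<noteq> {}" and "\<forall>r\<in>?R. Card_order r"
    using assms by (auto simp: card_of_Card_order)
  then obtain r where "r \<in> ?R" "\<forall>r'\<in>?R. r \<le>o r'"
    using exists_minim_Card_order[of ?R] by blast
  then show ?thesis
    by (auto simp: has_least_card_def)
qed

lemma dens_least:
  obtains D :: "'x::topological_space set" where "dens TYPE('x) = |D|" "has_least_card dense D"
proof
  show "has_least_card dense (SOME D :: 'x set. has_least_card dense D)"
    by (rule someI_ex, rule has_least_card_ex[of dense UNIV]) (simp add: dense_def)
qed (simp add: dens_def)

lemma baire_number_least:
  fixes s :: "'l::topological_space set rel"
  assumes "baire_number TYPE('l) = Some s"
  obtains \<G> :: "'l set set" where "s = |\<G>|" "has_least_card non_baire_family \<G>"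
proof -
  have ex: "\<exists>\<G> :: 'l set set. non_baire_family \<G>"
    and s: "s = |SOME \<G> :: 'l set set. has_least_card non_baire_family \<G>|"
    using assms by (auto simp: baire_number_def split: if_splits)
  from ex have "\<exists>\<G> :: 'l set set. has_least_card non_baire_family \<G>"
    using has_least_card_ex by blast
  from someI_ex[OF this] s show ?thesis
    using that by blast
qed

definition extremally_disconnected :: "'l::topological_space itself \<Rightarrow> bool" where
  "extremally_disconnected _ \<longleftrightarrow> (\<forall>U :: 'l set. open U \<longrightarrow> open (closure U))"


section \<open>Complex Banach spaces\<close>

text \<open>A complex Banach space is a real Banach space together with a compatible multiplication by
  complex scalars.\<close>

locale complex_banach = vector_space scaleC
  for scaleC :: "complex \<Rightarrow> 'x::banach \<Rightarrow> 'x" +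
  assumes scaleC_of_real: "scaleC (complex_of_real r) x = r *\<^sub>R x"
    and norm_scaleC: "norm (scaleC c x) = norm c * norm x"

text \<open>For compact \<open>'l\<close>, the type \<^typ>\<open>'l \<Rightarrow>\<^sub>C 'f\<close> is \<open>C(L, F)\<close> with the supremum norm.\<close>

definition scaleC_bcontfun ::
    "complex \<Rightarrow> ('l::topological_space \<Rightarrow>\<^sub>C complex) \<Rightarrow> ('l \<Rightarrow>\<^sub>C complex)" where
  "scaleC_bcontfun c f = Bcontfun (\<lambda>t. c * f t)"

lemma apply_scaleC_bcontfun [simp]: "scaleC_bcontfun c f t = c * f t"
proof -
  have "(\<lambda>t. c * f t) \<in> bcontfun"
  proof (rule bcontfun_normI)
    show "norm (c * f t) \<le> norm c * norm f" for t
      by (simp add: norm_mult mult_left_mono norm_bounded)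
  qed (intro continuous_intros continuous_on_apply_bcontfun)
  then show ?thesis
    by (simp add: scaleC_bcontfun_def Bcontfun_inverse)
qed


section \<open>The Bishop--Phelps--Bollobas property\<close>

text \<open>Here \<open>sX\<close> and \<open>sY\<close> are the multiplications by scalars from the field \<open>'f\<close>. An \<open>'f\<close>-linear
  bounded operator is in particular \<open>\<real>\<close>-linear, and its operator norm is the norm of
  the type \<^typ>\<open>'x \<Rightarrow>\<^sub>L 'y\<close>.\<close>

definition bounded_operators ::
    "('f \<Rightarrow> 'x::real_normed_vector \<Rightarrow> 'x) \<Rightarrow> ('f \<Rightarrow> 'y::real_normed_vector \<Rightarrow> 'y) \<Rightarrow> ('x \<Rightarrow>\<^sub>L 'y) set" where
  "bounded_operators sX sY = {T. \<forall>c x. blinfun_apply T (sX c x) = sY c (blinfun_apply T x)}"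

definition BPB_property ::
    "('f \<Rightarrow> 'x::real_normed_vector \<Rightarrow> 'x) \<Rightarrow> ('f \<Rightarrow> 'y::real_normed_vector \<Rightarrow> 'y)
      \<Rightarrow> (real \<Rightarrow> real) \<Rightarrow> bool" where
  "BPB_property sX sY \<eta> \<longleftrightarrow>
     (\<forall>\<epsilon>. 0 < \<epsilon> \<and> \<epsilon> < 1 \<longrightarrow>
       (\<forall>T \<in> bounded_operators sX sY. \<forall>x0.
          norm T = 1 \<and> norm x0 = 1 \<and> norm (blinfun_apply T x0) > 1 - \<eta> \<epsilon> \<longrightarrow>
          (\<exists>S \<in> bounded_operators sX sY. \<exists>u0.
             norm S = 1 \<and> norm u0 = 1 \<and> norm (blinfun_apply S u0) = 1 \<and>
             norm (u0 - x0) < \<epsilon> \<and> norm (S - T) < \<epsilon>)))"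

end

theory Submission
  imports Defs
begin

text \<open>Write \<open>\<phi>\<^sub>t\<close> for the real part of the functional \<open>x \<mapsto> T x t\<close>, rotated so that \<open>\<phi>\<^sub>t x0\<close> is close
  to \<open>1\<close> at some \<open>t\<close>. Ekeland's argument, run on pairs of a vector and a clopen set, gives a vector
  \<open>u\<close> near \<open>x0\<close> and a point \<open>t\<close> with \<open>\<phi>\<^sub>s y \<le> \<phi>\<^sub>s u + k \<parallel>y - u\<parallel> + d s\<close> for all \<open>y\<close> in the unit ball
  and all \<open>s\<close>, where \<open>d \<ge> 0\<close> is continuous and vanishes at \<open>t\<close>. Since \<open>L\<close> is extremally
  disconnected, \<open>C(L, \<real>)\<close> is Dedekind complete, so the Hahn--Banach theorem holds for operators into
  it and yields \<open>\<theta>\<close> of norm at most \<open>k\<close> such that \<open>\<phi> - \<theta>\<close> is at most \<open>D = (\<phi> - \<theta>) u + d\<close> on the unit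
  ball. On a clopen neighbourhood of \<open>t\<close> where \<open>D\<close> is near \<open>1\<close>, replace \<open>\<phi>\<close> by \<open>(\<phi> - \<theta>) / D\<close>: this has
  norm at most \<open>1\<close>, with equality attained at \<open>u\<close> because \<open>d t = 0\<close>.\<close>

section \<open>Extremally disconnected spaces: infima of continuous functions and clopen
  neighbourhoods\<close>

text \<open>This is the lower semicontinuous regularisation of the pointwise infimum of
  \<open>A\<close>, written with level sets because closures of open sets are exactly what extremal
  disconnectedness controls.\<close>

definition order_inf :: "('l::topological_space \<Rightarrow> real) set \<Rightarrow> 'l \<Rightarrow> real" where
  "order_inf A t = Inf {r. t \<in> closure (\<Union>f\<in>A. {s. f s < r})}"

text \<open>The sets \<open>C r\<close>, the closures of the open sets where some member of
  \<open>A\<close> is below \<open>r\<close>, are clopen and increase with \<open>r\<close>. Strict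
  sublevel sets of \<open>order_inf A\<close> are unions of sets \<open>C r\<close>, strict
  superlevel sets are unions of their complements, so both are open. A continuous lower bound
  exceeding \<open>order_inf A\<close> at \<open>t\<close> would exceed some \<open>r\<close> on an
  open set meeting \<open>U r\<close>, where a member of \<open>A\<close> is below
  \<open>r\<close>.\<close>

lemma order_inf_properties:
  fixes A :: "('l::topological_space \<Rightarrow> real) set"
  assumes ed: "extremally_disconnected TYPE('l)"
    and ne: "A \<noteq> {}"
    and cont: "\<And>f. f \<in> A \<Longrightarrow> continuous_on UNIV f"
    and bd: "\<And>f t. f \<in> A \<Longrightarrow> m \<le> f t"
  shows continuous_on_order_inf: "continuous_on UNIV (order_inf A)"
    and order_inf_lower: "f \<in> A \<Longrightarrow> order_inf A t \<le> f t"
    and order_inf_greatest: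
      "continuous_on UNIV h \<Longrightarrow> (\<And>f t. f \<in> A \<Longrightarrow> h t \<le> f t) \<Longrightarrow> h t \<le> order_inf A t"
proof -
  define U where "U r = (\<Union>f\<in>A. {s. f s < r})" for r
  define C where "C r = closure (U r)" for r
  have openU: "open (U r)" for r
    unfolding U_def using cont by (auto intro!: open_Collect_less)
  have openC: "open (C r)" for r
    using ed openU unfolding extremally_disconnected_def C_def by blast
  have closedC: "closed (C r)" for r
    unfolding C_def by simp
  have mono: "C r \<subseteq> C s" if "r \<le> s" for r s
    unfolding C_def U_def by (rule closure_mono) (use that in force)
  have inf_eq: "order_inf A t = Inf {r. t \<in> C r}" for t
    by (simp add: order_inf_def C_def U_def)
  have low: "m \<le> r" if "t \<in> C r" for r t
  proof (rule ccontr)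
    assume "\<not> m \<le> r"
    then have "\<not> f s < r" if "f \<in> A" for f s using bd[OF that, of s] by simp
    then have "U r = {}" unfolding U_def by blast
    then show False using that by (simp add: C_def)
  qed
  then have bdd: "bdd_below {r. t \<in> C r}" for t by (auto intro!: bdd_belowI)
  have UC: "U r \<subseteq> C r" for r unfolding C_def by (rule closure_subset)
  obtain f0 where f0: "f0 \<in> A" using ne by auto
  have "t \<in> C (f0 t + 1)" for t using UC f0 by (force simp: U_def)
  then have nonempty: "{r. t \<in> C r} \<noteq> {}" for t by auto
  have less_iff: "order_inf A t < a \<longleftrightarrow> (\<exists>r<a. t \<in> C r)" for t a
    unfolding inf_eq using cInf_less_iff[OF nonempty bdd] by auto
  have greater_iff: "a < order_inf A t \<longleftrightarrow> (\<exists>r>a. t \<notin> C r)" for t a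
  proof
    assume a: "a < order_inf A t"
    then obtain r where "a < r" "r < order_inf A t" using dense by blast
    then have "t \<notin> C r" unfolding inf_eq using cInf_lower[OF _ bdd, of r t] by auto
    then show "\<exists>r>a. t \<notin> C r" using \<open>a < r\<close> by auto
  next
    assume "\<exists>r>a. t \<notin> C r"
    then obtain r where r: "a < r" "t \<notin> C r" by auto
    have "r \<le> order_inf A t" unfolding inf_eq
    proof (rule cInf_greatest[OF nonempty])
      show "r \<le> x" if "x \<in> {r. t \<in> C r}" for x
        using that r mono[of x r] by (cases "x \<le> r") auto
    qed
    then show "a < order_inf A t" using r by simp
  qed
  show "continuous_on UNIV (order_inf A)"
  proof -
    have "open {t. order_inf A t < a}" "open {t. a < order_inf A t}" for a
    proof -
      have "{t. order_inf A t < a} = (\<Union>r\<in>{..<a}. C r)" using less_iff by auto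
      then show "open {t. order_inf A t < a}" using openC by auto
      have "{t. a < order_inf A t} = (\<Union>r\<in>{a<..}. - C r)" using greater_iff by auto
      then show "open {t. a < order_inf A t}" using closedC by (auto simp: open_Compl)
    qed
    then show ?thesis
      unfolding continuous_on_def order_tendsto_iff eventually_at_topological by blast
  qed
  show "order_inf A t \<le> f t" if "f \<in> A" for f t
  proof (rule field_le_epsilon)
    fix e :: real assume "0 < e"
    then have "t \<in> C (f t + e)" using UC that by (force simp: U_def)
    then show "order_inf A t \<le> f t + e" unfolding inf_eq by (intro cInf_lower bdd) auto
  qed
  show "h t \<le> order_inf A t"
    if h: "continuous_on UNIV h" "\<And>f t. f \<in> A \<Longrightarrow> h t \<le> f t" for h t
  proof (rule ccontr)
    assume "\<not> h t \<le> order_inf A t"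
    then obtain r where r: "r < h t" "t \<in> C r" using less_iff[of t "h t"] by auto
    have "open {s. r < h s}" using h(1) by (auto intro!: open_Collect_less)
    then have "{s. r < h s} \<inter> U r \<noteq> {}"
      using r open_Int_closure_eq_empty[of "{s. r < h s}" "U r"] by (auto simp: C_def)
    then obtain s f where "r < h s" "f \<in> A" "f s < r" unfolding U_def by blast
    then show False using h(2)[of f s] by simp
  qed
qed

text \<open>Disjoint open sets separate \<open>t\<close> from a point outside \<open>U\<close>, and
  the closure of the one around \<open>t\<close> is clopen and still misses that point. Compactness
  of \<open>- U\<close> reduces these closures to finitely many, whose intersection works.\<close>

lemma clopen_neighbourhood:
  fixes t :: "'l::t2_space"
  assumes "compact (UNIV :: 'l set)" "extremally_disconnected TYPE('l)" "open U" "t \<in> U"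
  obtains V where "open V" "closed V" "t \<in> V" "V \<subseteq> U"
proof -
  have "compact (- U)"
    using assms(1,3) compact_Int_closed[of UNIV "- U"] by (simp add: closed_Compl)
  define \<W> where "\<W> = {W. open W \<and> closed W \<and> t \<in> W}"
  have "- U \<subseteq> (\<Union>W\<in>\<W>. - W)"
  proof
    fix y assume "y \<in> - U"
    then have "t \<noteq> y" using assms(4) by auto
    then obtain A B where AB: "open A" "open B" "t \<in> A" "y \<in> B" "A \<inter> B = {}"
      using hausdorff by metis
    have "closure A \<in> \<W>"
      using assms(2) AB closure_subset by (auto simp: \<W>_def extremally_disconnected_def)
    moreover have "y \<notin> closure A"
      using AB open_Int_closure_eq_empty[of B A] by auto
    ultimately show "y \<in> (\<Union>W\<in>\<W>. - W)" by blast
  qed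
  then obtain F where F: "F \<subseteq> \<W>" "finite F" "- U \<subseteq> (\<Union>W\<in>F. - W)"
    using compactE_image[OF \<open>compact (- U)\<close>, of \<W> uminus] by (auto simp: \<W>_def)
  show ?thesis
  proof (rule that[of "\<Inter>F"])
    show "open (\<Inter>F)" "closed (\<Inter>F)" "t \<in> \<Inter>F"
      using F(1,2) by (auto simp: \<W>_def intro!: open_Inter closed_Inter)
    show "\<Inter>F \<subseteq> U" using F(3) by blast
  qed
qed

section \<open>Sublinear maps into C(L, R) and the Hahn-Banach theorem\<close>

text \<open>Homogeneity is only required as an inequality for positive scalars, which is easy to
  check for infima; equality follows. The bound by \<open>k * norm x\<close> also forces a lower
  bound, so that the infima formed below exist.\<close>

definition sublinear_map :: "real \<Rightarrow> ('x::real_normed_vector \<Rightarrow> 'l::topological_space \<Rightarrow> real) \<Rightarrow> bool" where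
  "sublinear_map k p \<longleftrightarrow>
     (\<forall>x. continuous_on UNIV (p x)) \<and>
     (\<forall>x y t. p (x + y) t \<le> p x t + p y t) \<and>
     (\<forall>c x t. 0 < c \<longrightarrow> p (c *\<^sub>R x) t \<le> c * p x t) \<and>
     (\<forall>x t. p x t \<le> k * norm x)"

lemma sublinear_map_zero:
  assumes "sublinear_map k p"
  shows "p 0 t = 0"
proof -
  \<comment> \<open>The factor 2 gives 0 \<le> \<open>p 0 t\<close>, the factor 1/2 gives
    \<open>p 0 t\<close> \<le> 0.\<close>
  have "p (2 *\<^sub>R 0) t \<le> 2 * p 0 t" "p ((1/2) *\<^sub>R 0) t \<le> (1/2) * p 0 t"
    using assms unfolding sublinear_map_def by (meson zero_less_numeral half_gt_zero zero_less_one)+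
  then show ?thesis by simp
qed

lemma sublinear_map_lower:
  assumes "sublinear_map k p"
  shows "- p (- x) t \<le> p x t" "- (k * norm x) \<le> p x t"
proof -
  have "p (x + - x) t \<le> p x t + p (- x) t" "p (- x) t \<le> k * norm (- x)"
    using assms unfolding sublinear_map_def by blast+
  then show "- p (- x) t \<le> p x t" "- (k * norm x) \<le> p x t"
    using sublinear_map_zero[OF assms, of t] by simp_all
qed

lemma sublinear_map_scale:
  assumes "sublinear_map k p" "0 \<le> c"
  shows "p (c *\<^sub>R x) t = c * p x t"
proof (cases "c = 0")
  case True
  then show ?thesis using sublinear_map_zero[OF assms(1)] by simp
next
  case False
  then have c: "0 < c" using assms by simp
  have 1: "p (c *\<^sub>R x) t \<le> c * p x t"
    using assms c unfolding sublinear_map_def by blast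
  have "p (inverse c *\<^sub>R (c *\<^sub>R x)) t \<le> inverse c * p (c *\<^sub>R x) t"
    using assms(1) c unfolding sublinear_map_def by (meson positive_imp_inverse_positive)
  then have "c * p x t \<le> p (c *\<^sub>R x) t"
    using c by (simp add: field_simps)
  then show ?thesis using 1 by simp
qed

text \<open>Common source of the two sublinear maps built as infima: one for the sandwich, one for
  chains in Zorn's lemma. It suffices that sums and positive multiples of members of the families
  dominate members of the right family.\<close>

lemma sublinear_map_order_inf:
  fixes F :: "'x::real_normed_vector \<Rightarrow> ('l::topological_space \<Rightarrow> real) set"
  assumes ed: "extremally_disconnected TYPE('l)"
    and cont: "\<And>x f. f \<in> F x \<Longrightarrow> continuous_on UNIV f"
    and low: "\<And>x f t. f \<in> F x \<Longrightarrow> - (k * norm x) \<le> f t"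
    and up: "\<And>x. \<exists>f\<in>F x. \<forall>t. f t \<le> k * norm x"
    and add: "\<And>x y f g. f \<in> F x \<Longrightarrow> g \<in> F y \<Longrightarrow> \<exists>h\<in>F (x + y). \<forall>t. h t \<le> f t + g t"
    and scale: "\<And>c x f. 0 < c \<Longrightarrow> f \<in> F x \<Longrightarrow> \<exists>h\<in>F (c *\<^sub>R x). \<forall>t. h t \<le> c * f t"
  shows "sublinear_map k (\<lambda>x. order_inf (F x))"
proof -
  have ne: "F x \<noteq> {}" for x using up by blast
  have c: "continuous_on UNIV (order_inf (F x))" for x
    by (rule continuous_on_order_inf[OF ed ne, where m = "- (k * norm x)"]) (use cont low in auto)
  have lower: "order_inf (F x) t \<le> f t" if "f \<in> F x" for x f t
    by (rule order_inf_lower[OF ed ne, where m = "- (k * norm x)"]) (use that cont low in auto)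
  have greatest: "h t \<le> order_inf (F x) t"
    if "continuous_on UNIV h" "\<And>f t. f \<in> F x \<Longrightarrow> h t \<le> f t" for h t x
    
    by (rule order_inf_greatest[OF ed ne, where m = "- (k * norm x)"]) (use that cont low in auto)
  \<comment> \<open>The infimum is not pointwise, so only continuous lower bounds pass to it. Hence
    the two infima are taken one after the other: first over \<open>F y\<close> with
    \<open>f\<close> fixed, then over \<open>F x\<close>.\<close>
  have "order_inf (F (x + y)) t \<le> order_inf (F x) t + order_inf (F y) t" for x y t
  proof -
    have 1: "order_inf (F (x + y)) t \<le> f t + g t" if "f \<in> F x" "g \<in> F y" for f g t
      using add[OF that] lower order.trans by blast
    have 2: "order_inf (F (x + y)) t - f t \<le> order_inf (F y) t" if "f \<in> F x" for f t
      by (rule greatest) (use 1[OF that] in \<open>auto intro!: continuous_intros c cont[OF that] simp: algebra_simps\<close>)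
    have "order_inf (F (x + y)) t - order_inf (F y) t \<le> order_inf (F x) t"
      by (rule greatest) (use 2 in \<open>auto intro!: continuous_intros c simp: algebra_simps\<close>)
    then show ?thesis by simp
  qed
  moreover have "order_inf (F (a *\<^sub>R x)) t \<le> a * order_inf (F x) t" if "0 < a" for a x t
  proof -
    have 1: "order_inf (F (a *\<^sub>R x)) t \<le> a * f t" if "f \<in> F x" for f t
      using scale[OF \<open>0 < a\<close> that] lower order.trans by blast
    have "order_inf (F (a *\<^sub>R x)) t / a \<le> order_inf (F x) t"
      by (rule greatest) (use 1 that in \<open>auto intro!: continuous_intros c simp: field_simps\<close>)
    then show ?thesis using that by (simp add: field_simps)
  qed
  moreover have "order_inf (F x) t \<le> k * norm x" for x t
    using up lower order.trans by blast
  ultimately show ?thesis unfolding sublinear_map_def using c by blast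
qed

text \<open>The sublinear map \<open>x \<mapsto> inf {p (x + a z) - a g z | a \<ge> 0, z \<in> C}\<close>: every linear map below it
  lies between \<open>g\<close> and \<open>p\<close>.\<close>

lemma sublinear_map_sandwich:
  fixes p :: "'x::real_normed_vector \<Rightarrow> 'l::topological_space \<Rightarrow> real"
  assumes ed: "extremally_disconnected TYPE('l)"
    and p: "sublinear_map k p"
    and C: "convex C" "C \<noteq> {}"
    and contg: "\<And>z. z \<in> C \<Longrightarrow> continuous_on UNIV (g z)"
    and gp: "\<And>z t. z \<in> C \<Longrightarrow> g z t \<le> p z t"
    and concave: "\<And>z w a b t. z \<in> C \<Longrightarrow> w \<in> C \<Longrightarrow> 0 \<le> a \<Longrightarrow> 0 \<le> b \<Longrightarrow> a + b = 1 \<Longrightarrow>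
      a * g z t + b * g w t \<le> g (a *\<^sub>R z + b *\<^sub>R w) t"
  obtains q where "sublinear_map k q" "\<And>x t. q x t \<le> p x t"
    "\<And>z t. z \<in> C \<Longrightarrow> q (- z) t \<le> - g z t"
proof -
  define F where "F x = {(\<lambda>t. p (x + a *\<^sub>R z) t - a * g z t) | a z. 0 \<le> a \<and> z \<in> C}" for x
  have contp: "continuous_on UNIV (p x)" 
    and subadd: "p (x + y) t \<le> p x t + p y t"
    and bound: "p x t \<le> k * norm x" for x y t
    using p unfolding sublinear_map_def by blast+
  note scalep = sublinear_map_scale[OF p]
  obtain z0 where z0: "z0 \<in> C" using C by auto
  have pF: "p x \<in> F x" for x
    unfolding F_def using z0 by (auto intro!: exI[of _ "0::real"] exI[of _ z0])
  have contF: "continuous_on UNIV f" if "f \<in> F x" for f x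
    using that unfolding F_def by (auto intro!: continuous_intros contp contg)
  have lowF: "- (k * norm x) \<le> f t" if fF: "f \<in> F x" for f x t
  proof -
    obtain a z where f: "f = (\<lambda>t. p (x + a *\<^sub>R z) t - a * g z t)" and a: "0 \<le> a" "z \<in> C"
      using fF unfolding F_def by blast
    \<comment> \<open>Cancelling \<open>x\<close> bounds \<open>p (a z)\<close>, hence
      \<open>a * g z\<close>, by the first term of \<open>f\<close> plus
      \<open>p (- x)\<close>.\<close>
    have "p (x + a *\<^sub>R z + - x) t \<le> p (x + a *\<^sub>R z) t + p (- x) t" by (rule subadd)
    moreover have "p (x + a *\<^sub>R z + - x) t = a * p z t" using scalep[OF a(1)] by simp
    moreover have "a * g z t \<le> a * p z t" using a gp by (simp add: mult_left_mono)
    moreover have "p (- x) t \<le> k * norm x" using bound[of "- x"] by simp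
    ultimately show ?thesis unfolding f by simp
  qed
  have sub: "sublinear_map k (\<lambda>x. order_inf (F x))"
  proof (rule sublinear_map_order_inf[OF ed])
    show "\<exists>f\<in>F x. \<forall>t. f t \<le> k * norm x" for x using pF bound by blast
  next
    fix x y f h assume "f \<in> F x" "h \<in> F y"
    then obtain a z b w where f: "f = (\<lambda>t. p (x + a *\<^sub>R z) t - a * g z t)" and a: "0 \<le> a" "z \<in> C"
      and h: "h = (\<lambda>t. p (y + b *\<^sub>R w) t - b * g w t)" and b: "0 \<le> b" "w \<in> C"
      unfolding F_def by blast
    show "\<exists>e\<in>F (x + y). \<forall>t. e t \<le> f t + h t"
    proof (cases "a + b = 0")
      case True
      then have "a = 0" "b = 0" using a b by auto
      \<comment> \<open>No convex combination can be formed here; \<open>p (x + y)\<close>, the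
        member with coefficient zero, serves.\<close>
      then show ?thesis using pF[of "x + y"] subadd[of x y] unfolding f h by auto
    next
      case False
      \<comment> \<open>The two displacements merge into one: \<open>a z + b w\<close> is
        \<open>s\<close> times the convex combination \<open>v\<close>, which lies in
        \<open>C\<close>, and concavity of \<open>g\<close> compares the subtracted terms.\<close>
      define s where "s = a + b"
      have s: "s > 0" using False a b by (simp add: s_def)
      define v where "v = (a / s) *\<^sub>R z + (b / s) *\<^sub>R w"
      have ab: "a / s + b / s = 1" "0 \<le> a / s" "0 \<le> b / s"
        using s a b by (auto simp: s_def add_divide_distrib[symmetric])
      have v: "v \<in> C" unfolding v_def using C(1) a b ab by (auto simp: convex_def)
      have sv: "s *\<^sub>R v = a *\<^sub>R z + b *\<^sub>R w" unfolding v_def using s by (simp add: scaleR_right_distrib)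
      have le: "p ((x + y) + s *\<^sub>R v) t - s * g v t \<le> f t + h t" for t
      proof -
        have "p ((x + a *\<^sub>R z) + (y + b *\<^sub>R w)) t \<le> p (x + a *\<^sub>R z) t + p (y + b *\<^sub>R w) t"
          by (rule subadd)
        moreover have "(x + a *\<^sub>R z) + (y + b *\<^sub>R w) = (x + y) + s *\<^sub>R v" unfolding sv by simp
        moreover have "s * ((a / s) * g z t + (b / s) * g w t) \<le> s * g v t"
          unfolding v_def using s a b ab by (intro mult_left_mono concave) auto
        moreover have "s * ((a / s) * g z t + (b / s) * g w t) = a * g z t + b * g w t"
          using s by (simp add: field_simps)
        ultimately show ?thesis unfolding f h by simp
      qed
      have mem: "(\<lambda>t. p ((x + y) + s *\<^sub>R v) t - s * g v t) \<in> F (x + y)"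
        unfolding F_def using s v by force
      show ?thesis by (intro rev_bexI[OF mem] allI) (rule le)
    qed
  next
    fix c x f assume c: "(0::real) < c" and "f \<in> F x"
    then obtain a z where f: "f = (\<lambda>t. p (x + a *\<^sub>R z) t - a * g z t)" and a: "0 \<le> a" "z \<in> C"
      unfolding F_def by blast
    have eq: "p (c *\<^sub>R x + (c * a) *\<^sub>R z) t - (c * a) * g z t = c * f t" for t
      using scalep[of c "x + a *\<^sub>R z" t] c unfolding f by (simp add: algebra_simps)
    have mem: "(\<lambda>t. p (c *\<^sub>R x + (c * a) *\<^sub>R z) t - (c * a) * g z t) \<in> F (c *\<^sub>R x)"
      unfolding F_def using c a by force
    show "\<exists>h\<in>F (c *\<^sub>R x). \<forall>t. h t \<le> c * f t"
      by (intro rev_bexI[OF mem] allI eq_refl) (rule eq)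
  qed (use contF lowF in auto)
  have lower: "order_inf (F x) t \<le> f t" if "f \<in> F x" for x f t

    by (rule order_inf_lower[OF ed, where m = "- (k * norm x)"]) (use that contF lowF in auto)
  show thesis
  proof (rule that[OF sub])
    show "order_inf (F x) t \<le> p x t" for x t using lower pF by blast
    show "order_inf (F (- z)) t \<le> - g z t" if "z \<in> C" for z t
    proof -
      \<comment> \<open>Coefficient 1 and the same \<open>z\<close> make the argument of
        \<open>p\<close> vanish.\<close>
      have "(\<lambda>t. p (- z + 1 *\<^sub>R z) t - 1 * g z t) \<in> F (- z)"
        unfolding F_def mem_Collect_eq using that by (intro exI[of _ "1::real"] exI[of _ z]) auto
      from lower[OF this, of t] show ?thesis using sublinear_map_zero[OF p] by simp
    qed
  qed
qed

text \<open>Zorn's lemma for the reversed order. A nonempty chain is bounded below by its infimum in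
  C(L, R), taken at each \<open>x\<close>; the uniform lower bound \<open>- (k * norm x)\<close>
  keeps it finite.\<close>

lemma sublinear_map_minimal:
  fixes p :: "'x::real_normed_vector \<Rightarrow> 'l::topological_space \<Rightarrow> real"
  assumes ed: "extremally_disconnected TYPE('l)" and p: "sublinear_map k p"
  obtains q where "sublinear_map k q" "q \<le> p" "\<And>r. sublinear_map k r \<Longrightarrow> r \<le> q \<Longrightarrow> r = q"
proof -
  define S where "S = {q. sublinear_map k q \<and> q \<le> p}"
  have "\<exists>m\<in>S. \<forall>a\<in>S. m \<ge> a \<longrightarrow> a = m"
  proof (rule predicate_Zorn)
    show "partial_order_on S (relation_of (\<ge>) S)"
      by (rule partial_order_on_relation_ofI) auto
  next
    fix C assume chain: "C \<in> Chains (relation_of (\<ge>) S)"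
    then have CS: "C \<subseteq> S" and total: "\<And>a b. a \<in> C \<Longrightarrow> b \<in> C \<Longrightarrow> a \<ge> b \<or> b \<ge> a"
      by (auto simp: Chains_def relation_of_def)
    show "\<exists>u\<in>S. \<forall>a\<in>C. a \<ge> u"
    proof (cases "C = {}")
      case True
      then show ?thesis using p by (auto simp: S_def)
    next
      case False
      then obtain q0 where q0: "q0 \<in> C" by auto
      define F where "F x = (\<lambda>q. q x) ` C" for x
      have sub: "sublinear_map k q" if "q \<in> C" for q using that CS by (auto simp: S_def)
      have contF: "continuous_on UNIV f" if "f \<in> F x" for f x
        using that sub unfolding F_def sublinear_map_def by auto
      have lowF: "- (k * norm x) \<le> f t" if "f \<in> F x" for f x t
        using that sub sublinear_map_lower(2) unfolding F_def by blast
      have lower: "order_inf (F x) t \<le> q x t" if "q \<in> C" for q x t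
      proof -
        have "q x \<in> F x" using that by (simp add: F_def)
        then show ?thesis
          by (intro order_inf_lower[OF ed, where m = "- (k * norm x)"]) (use contF lowF in auto)
      qed
      have "sublinear_map k (\<lambda>x. order_inf (F x))"
      proof (rule sublinear_map_order_inf[OF ed])
        show "\<exists>f\<in>F x. \<forall>t. f t \<le> k * norm x" for x
          using sub[OF q0] q0 unfolding F_def sublinear_map_def by blast
      next
        fix x y f g assume "f \<in> F x" "g \<in> F y"
        then obtain a b where ab: "a \<in> C" "b \<in> C" "f = a x" "g = b y" by (auto simp: F_def)
        \<comment> \<open>Subadditivity compares values of two different maps of the chain; the
          smaller of the two is below both.\<close>
        obtain c where c: "c \<in> C" "c \<le> a" "c \<le> b" using total[OF ab(1,2)] ab by blast
        have "c (x + y) t \<le> f t + g t" for t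
        proof -
          have "c (x + y) t \<le> c x t + c y t" using sub[OF c(1)] unfolding sublinear_map_def by blast
          also have "\<dots> \<le> f t + g t" using c ab by (auto simp: le_fun_def intro!: add_mono)
          finally show ?thesis .
        qed
        then show "\<exists>h\<in>F (x + y). \<forall>t. h t \<le> f t + g t" using c by (auto simp: F_def)
      next
        fix c x f assume "(0::real) < c" "f \<in> F x"
        then show "\<exists>h\<in>F (c *\<^sub>R x). \<forall>t. h t \<le> c * f t"
          using sub unfolding F_def sublinear_map_def by blast
      qed (use contF lowF in auto)
      moreover have "(\<lambda>x. order_inf (F x)) \<le> q" if "q \<in> C" for q
        using lower[OF that] by (simp add: le_fun_def)
      ultimately show ?thesis using q0 CS unfolding S_def
        by (intro bexI[of _ "\<lambda>x. order_inf (F x)"]) (auto intro: order.trans)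
    qed
  qed
  then show thesis using that unfolding S_def by (metis (no_types, lifting) mem_Collect_eq order.trans)
qed

text \<open>The sandwich with the single point \<open>y\<close> and \<open>g = p\<close> yields a
  sublinear map below \<open>p\<close> whose value at \<open>- y\<close> is at most
  \<open>- p y\<close>. By minimality it is \<open>p\<close> itself, so \<open>p\<close> is odd, and
  an odd sublinear map is linear.\<close>

lemma sublinear_map_minimal_linear:
  fixes p :: "'x::real_normed_vector \<Rightarrow> 'l::topological_space \<Rightarrow> real"
  assumes ed: "extremally_disconnected TYPE('l)" and p: "sublinear_map k p"
    and minimal: "\<And>r. sublinear_map k r \<Longrightarrow> r \<le> p \<Longrightarrow> r = p"
  shows "linear (\<lambda>x. p x t)"
proof -
  have subadd: "p (x + y) t \<le> p x t + p y t" for x y using p unfolding sublinear_map_def by blast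
  have neg: "p (- y) t = - p y t" for y
  proof -
    obtain q where q: "sublinear_map k q" "\<And>x t. q x t \<le> p x t" "\<And>z t. z \<in> {y} \<Longrightarrow> q (- z) t \<le> - p z t"
    proof (rule sublinear_map_sandwich[OF ed p, of "{y}" p])
      show "continuous_on UNIV (p z)" for z using p unfolding sublinear_map_def by blast
      show "a * p z t + b * p w t \<le> p (a *\<^sub>R z + b *\<^sub>R w) t"
        if "z \<in> {y}" "w \<in> {y}" "0 \<le> a" "0 \<le> b" "a + b = 1" for z w a b t
        using that by (simp add: distrib_right[symmetric] scaleR_add_left[symmetric])
    qed auto
    then have "q = p" using minimal by (simp add: le_fun_def)
    then have "p (- y) t \<le> - p y t" using q(3)[of y t] by simp
    then show ?thesis using sublinear_map_lower(1)[OF p, of y t] by simp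
  qed
  show ?thesis
  proof (rule linearI)
    show "p (x + y) t = p x t + p y t" for x y
      using subadd[of x y] subadd[of "x + y" "- y"] neg[of y] by simp
    show "p (c *\<^sub>R x) t = c *\<^sub>R p x t" for c x
    proof (cases "0 \<le> c")
      case False
      then have "p ((- c) *\<^sub>R x) t = - c * p x t" by (intro sublinear_map_scale[OF p]) auto
      then show ?thesis using neg[of "c *\<^sub>R x"] by simp
    qed (simp add: sublinear_map_scale[OF p])
  qed
qed

text \<open>A minimal sublinear map below the sandwich map for \<open>k * norm x\<close> is linear.
  It inherits the norm bound from above, and its values at \<open>- z\<close> turn into the lower
  bound \<open>g z\<close> by linearity.\<close>

lemma Hahn_Banach_sandwich:
  fixes g :: "'x::real_normed_vector \<Rightarrow> 'l::topological_space \<Rightarrow> real"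
  assumes ed: "extremally_disconnected TYPE('l)"
    and k: "0 \<le> k"
    and C: "convex C" "C \<noteq> {}"
    and contg: "\<And>z. z \<in> C \<Longrightarrow> continuous_on UNIV (g z)"
    and gk: "\<And>z t. z \<in> C \<Longrightarrow> g z t \<le> k * norm z"
    and concave: "\<And>z w a b t. z \<in> C \<Longrightarrow> w \<in> C \<Longrightarrow> 0 \<le> a \<Longrightarrow> 0 \<le> b \<Longrightarrow> a + b = 1 \<Longrightarrow>
      a * g z t + b * g w t \<le> g (a *\<^sub>R z + b *\<^sub>R w) t"
  obtains \<theta> where "\<And>x. continuous_on UNIV (\<theta> x)" "\<And>t. linear (\<lambda>x. \<theta> x t)"
    "\<And>x t. \<bar>\<theta> x t\<bar> \<le> k * norm x" "\<And>z t. z \<in> C \<Longrightarrow> g z t \<le> \<theta> z t"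
proof -
  have "sublinear_map k (\<lambda>(x::'x) (t::'l). k * norm x)"
    unfolding sublinear_map_def using k
    by (auto simp: distrib_left[symmetric] norm_triangle_ineq mult_left_mono)
  then obtain q where q: "sublinear_map k q" "\<And>z t. z \<in> C \<Longrightarrow> q (- z) t \<le> - g z t"
    by (rule sublinear_map_sandwich[OF ed _ C, where g = g]) (use contg gk concave in auto)
  obtain \<theta> where \<theta>: "sublinear_map k \<theta>" "\<theta> \<le> q" "\<And>r. sublinear_map k r \<Longrightarrow> r \<le> \<theta> \<Longrightarrow> r = \<theta>"
    using sublinear_map_minimal[OF ed q(1)] by metis
  have lin: "linear (\<lambda>x. \<theta> x t)" for t by (rule sublinear_map_minimal_linear[OF ed \<theta>(1,3)])
  show thesis
  proof (rule that[of \<theta>, OF _ lin])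
    show "continuous_on UNIV (\<theta> x)" for x using \<theta>(1) unfolding sublinear_map_def by blast
    show "\<bar>\<theta> x t\<bar> \<le> k * norm x" for x t
      using \<theta>(1) sublinear_map_lower(2)[OF \<theta>(1), of x t] unfolding sublinear_map_def
      by (meson abs_le_iff minus_le_iff)
    show "g z t \<le> \<theta> z t" if "z \<in> C" for z t
    proof -
      have "\<theta> (- z) t \<le> q (- z) t" using \<theta>(2) by (simp add: le_fun_def)
      then show ?thesis using q(2)[OF that, of t] linear_neg[OF lin[of t], of z] by simp
    qed
  qed
qed

section \<open>Ekeland's variational principle on pairs of a vector and a clopen set\<close>

text \<open>If every admissible pair could be improved by more than \<open>e\<close> at some point,
  then shrinking the clopen set and iterating would raise \<phi> by any multiple of \<open>e\<close>
  over its value at \<open>x\<close>. On the unit ball \<phi> varies by at most 2.\<close>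

lemma Ekeland_step:
  fixes \<phi> :: "'x::real_normed_vector \<Rightarrow> 'l::t2_space \<Rightarrow> real"
  assumes L: "compact (UNIV :: 'l set)" "extremally_disconnected TYPE('l)"
    and cont: "\<And>x. continuous_on UNIV (\<phi> x)"
    and bd: "\<And>x t. \<bar>\<phi> x t\<bar> \<le> norm x"
    and k: "0 \<le> k" and e: "0 < e"
    and x: "norm x \<le> 1" and V: "open V" "closed V" "V \<noteq> {}"
  obtains y W where "norm y \<le> 1" "open W" "closed W" "W \<noteq> {}" "W \<subseteq> V"
    "\<And>t. t \<in> W \<Longrightarrow> k * norm (y - x) \<le> \<phi> y t - \<phi> x t"
    "\<And>t z. t \<in> W \<Longrightarrow> norm z \<le> 1 \<Longrightarrow> \<phi> z t \<le> \<phi> y t + k * norm (z - y) + e"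
proof -
  define P where "P y W \<longleftrightarrow> norm y \<le> 1 \<and> open W \<and> closed W \<and> W \<noteq> {} \<and> W \<subseteq> V \<and>
    (\<forall>t\<in>W. k * norm (y - x) \<le> \<phi> y t - \<phi> x t)" for y W
  have "\<exists>y W. P y W \<and> (\<forall>t\<in>W. \<forall>z. norm z \<le> 1 \<longrightarrow> \<phi> z t \<le> \<phi> y t + k * norm (z - y) + e)"
  proof (rule ccontr)
    assume "\<not> ?thesis"
    then have no: "\<exists>t\<in>W. \<exists>z. norm z \<le> 1 \<and> \<phi> y t + k * norm (z - y) + e < \<phi> z t" if "P y W" for y W
      using that by force
    have gain: "\<exists>y W. P y W \<and> (\<forall>t\<in>W. \<phi> x t + real n * e \<le> \<phi> y t)" for n
    proof (induction n)
      case 0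
      show ?case using x V by (intro exI[of _ x] exI[of _ V]) (auto simp: P_def)
    next
      case (Suc n)
      then obtain y W where yW: "P y W" "\<forall>t\<in>W. \<phi> x t + real n * e \<le> \<phi> y t" by blast
      then obtain t z where z: "t \<in> W" "norm z \<le> 1" "\<phi> y t + k * norm (z - y) + e < \<phi> z t"
        using no by blast
      \<comment> \<open>The improvement at the single point \<open>t\<close> is a strict inequality
        between continuous functions, so it persists on a clopen neighbourhood.\<close>
      have "open (W \<inter> {s. \<phi> y s + k * norm (z - y) + e < \<phi> z s})"
        using yW by (intro open_Int open_Collect_less continuous_intros cont) (auto simp: P_def)
      then obtain W' where W': "open W'" "closed W'" "t \<in> W'"
        "W' \<subseteq> W \<inter> {s. \<phi> y s + k * norm (z - y) + e < \<phi> z s}"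
        by (rule clopen_neighbourhood[OF L, of _ t]) (use z in auto)
      have step: "\<phi> y s + k * norm (z - y) + e < \<phi> z s" if "s \<in> W'" for s
        using W' that by auto
      \<comment> \<open>Admissibility is measured from the original \<open>x\<close>, not from the
        previous \<open>y\<close>; the triangle inequality carries it over.\<close>
      have tri: "k * norm (z - x) \<le> k * norm (z - y) + k * norm (y - x)"
        using k norm_triangle_ineq[of "z - y" "y - x"] mult_left_mono[of _ _ k]
        by (fastforce simp: distrib_left[symmetric])
      have kpos: "0 \<le> k * norm (z - y)" using k by simp
      have yx: "k * norm (y - x) \<le> \<phi> y s - \<phi> x s" if "s \<in> W'" for s
        using yW(1) W'(4) that unfolding P_def by blast
      have "k * norm (z - x) \<le> \<phi> z s - \<phi> x s" if "s \<in> W'" for s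
        using step[OF that] yx[OF that] tri e by linarith
      moreover have "\<phi> x s + real (Suc n) * e \<le> \<phi> z s" if "s \<in> W'" for s
      proof -
        have "\<phi> x s + real n * e \<le> \<phi> y s" using yW(2) W'(4) that by blast
        then show ?thesis using step[OF that] kpos by (simp add: algebra_simps)
      qed
      moreover have "W' \<subseteq> V" using W' yW(1) by (auto simp: P_def)
      ultimately show ?case using W' z(2) by (intro exI[of _ z] exI[of _ W']) (auto simp: P_def)
    qed
    obtain n where n: "2 < real n * e" using e reals_Archimedean3 by blast
    obtain y W where yW: "P y W" "\<forall>t\<in>W. \<phi> x t + real n * e \<le> \<phi> y t" using gain by blast
    then obtain t where t: "t \<in> W" "norm y \<le> 1" by (auto simp: P_def)
    have "\<bar>\<phi> x t\<bar> \<le> 1" "\<bar>\<phi> y t\<bar> \<le> 1" using bd t(2) x order.trans by blast+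
    then show False using yW(2) t(1) n by force
  qed
  then show thesis using that unfolding P_def by blast
qed

text \<open>The nested clopen sets need not have an interior in common, so the extremality of \<open>u\<close> holds
  near \<open>t\<close> only up to an error that tends to zero at \<open>t\<close>.\<close>

lemma Ekeland_principle:
  fixes \<phi> :: "'x::banach \<Rightarrow> 'l::t2_space \<Rightarrow> real"
  assumes L: "compact (UNIV :: 'l set)" "extremally_disconnected TYPE('l)"
    and cont: "\<And>x. continuous_on UNIV (\<phi> x)"
    and lin: "\<And>t. linear (\<lambda>x. \<phi> x t)"
    and bd: "\<And>x t. \<bar>\<phi> x t\<bar> \<le> norm x"
    and k: "0 < k" and x0: "norm x0 \<le> 1" and t0: "a < \<phi> x0 t0"
  obtains u t where "norm u \<le> 1" "k * norm (u - x0) \<le> \<phi> u t - \<phi> x0 t" "a < \<phi> x0 t"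
    "\<And>\<delta>. 0 < \<delta> \<Longrightarrow> \<exists>V. open V \<and> closed V \<and> t \<in> V \<and>
       (\<forall>s\<in>V. \<forall>y. norm y \<le> 1 \<longrightarrow> \<phi> y s \<le> \<phi> u s + k * norm (y - u) + \<delta>)"
proof -
  have "open {t. a < \<phi> x0 t}" by (intro open_Collect_less continuous_intros cont)
  then obtain V0 where V0: "open V0" "closed V0" "t0 \<in> V0" "V0 \<subseteq> {t. a < \<phi> x0 t}"
    by (rule clopen_neighbourhood[OF L, of _ t0]) (use t0 in auto)
  \<comment> \<open>The clause for \<open>n = 0\<close> makes dependent choice start at
    \<open>(x0, V0)\<close>; the transitions in \<open>Q\<close> have errors tending to
    zero.\<close>
  define P where "P = (\<lambda>(n::nat) (x, V). norm x \<le> 1 \<and> open V \<and> closed V \<and> V \<noteq> {} \<and> (n = 0 \<longrightarrow> x = x0 \<and> V = V0))"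
  define Q where "Q = (\<lambda>(n::nat) (x, V) (y, W). W \<subseteq> V \<and> (\<forall>t\<in>W. k * norm (y - x) \<le> \<phi> y t - \<phi> x t) \<and>
    (\<forall>t\<in>W. \<forall>z. norm z \<le> 1 \<longrightarrow> \<phi> z t \<le> \<phi> y t + k * norm (z - y) + inverse (Suc n)))"
  have ex0: "\<exists>p. P 0 p" using x0 V0 by (auto simp: P_def)
  have exS: "\<exists>q. P (Suc n) q \<and> Q n p q" if "P n p" for p n
  proof (cases p)
    case (Pair x V)
    have "0 < inverse (real (Suc n))" by simp
    then obtain y W where "norm y \<le> 1" "open W" "closed W" "W \<noteq> {}" "W \<subseteq> V"
      "\<And>t. t \<in> W \<Longrightarrow> k * norm (y - x) \<le> \<phi> y t - \<phi> x t"
      "\<And>t z. t \<in> W \<Longrightarrow> norm z \<le> 1 \<Longrightarrow> \<phi> z t \<le> \<phi> y t + k * norm (z - y) + inverse (Suc n)"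
      by (rule Ekeland_step[OF L cont bd less_imp_le[OF k], of _ x V])
        (use \<open>P n p\<close> Pair in \<open>auto simp: P_def\<close>)
    then show ?thesis using Pair by (intro exI[of _ "(y, W)"]) (auto simp: P_def Q_def)
  qed
  obtain f where f: "\<And>n. P n (f n)" "\<And>n. Q n (f n) (f (Suc n))"
    using dependent_nat_choice[of P Q, OF ex0 exS] by blast
  define x where "x n = fst (f n)" for n
  define V where "V n = snd (f n)" for n
  have fx: "f n = (x n, V n)" for n by (simp add: x_def V_def)
  have x_norm: "norm (x n) \<le> 1" and openV: "open (V n)" and closedV: "closed (V n)" and neV: "V n \<noteq> {}"
    for n using f(1)[of n] by (auto simp: P_def fx)
  have start: "x 0 = x0" "V 0 = V0" using f(1)[of 0] by (auto simp: P_def fx)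
  have Vsub: "V (Suc n) \<subseteq> V n" 
    and incr: "t \<in> V (Suc n) \<Longrightarrow> k * norm (x (Suc n) - x n) \<le> \<phi> (x (Suc n)) t - \<phi> (x n) t"
    and maxi: "t \<in> V (Suc n) \<Longrightarrow> norm z \<le> 1 \<Longrightarrow>
      \<phi> z t \<le> \<phi> (x (Suc n)) t + k * norm (z - x (Suc n)) + inverse (Suc n)" for n t z
    using f(2)[of n] by (auto simp: Q_def fx)
  have Vmono: "V n \<subseteq> V m" if "m \<le> n" for m n
    using that Vsub by (rule lift_Suc_antimono_le[rotated])
  \<comment> \<open>Compactness supplies a point \<open>t\<close> common to all the nested clopen
    sets, at which every step inequality holds.\<close>
  have "UNIV \<inter> \<Inter>(range V) \<noteq> {}"
  proof (rule compact_imp_fip[OF L(1)])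
    fix F assume F: "finite F" "F \<subseteq> range V"
    then obtain N where N: "finite N" "F = V ` N" by (meson finite_subset_image)
    show "UNIV \<inter> \<Inter>F \<noteq> {}"
    proof (cases "N = {}")
      case False
      then have "V (Max N) \<subseteq> V m" if "m \<in> N" for m using N that by (intro Vmono) auto
      then have "V (Max N) \<subseteq> \<Inter>F" unfolding N(2) by blast
      then show ?thesis using neV[of "Max N"] by blast
    qed (use N in auto)
  qed (use closedV in auto)
  then obtain t where t: "\<And>n. t \<in> V n" by auto
  have dist_le: "k * norm (x n - x m) \<le> \<phi> (x n) t - \<phi> (x m) t" if "m \<le> n" for m n
    using that
  proof (induction n rule: dec_induct)
    case (step n)
    have "k * norm (x (Suc n) - x m) \<le> k * (norm (x (Suc n) - x n) + norm (x n - x m))"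
      using k norm_triangle_ineq[of "x (Suc n) - x n" "x n - x m"] by (intro mult_left_mono) auto
    then show ?case using step.IH incr[OF t, of n] by (simp add: algebra_simps)
  qed simp
  \<comment> \<open>The values at \<open>t\<close> increase and stay in [-1, 1]. Since
    \<open>k\<close> is positive, \<open>dist_le\<close> transfers their Cauchy property to the
    vectors.\<close>
  have "convergent (\<lambda>n. \<phi> (x n) t)"
  proof (rule Bseq_monoseq_convergent)
    show "Bseq (\<lambda>n. \<phi> (x n) t)" 
      by (rule BseqI'[of _ 1]) (use bd x_norm order.trans in \<open>fastforce simp: real_norm_def\<close>)
    show "monoseq (\<lambda>n. \<phi> (x n) t)"
      unfolding monoseq_Suc using incr t k by (smt (verit) norm_ge_zero mult_nonneg_nonneg)
  qed
  then have C: "Cauchy (\<lambda>n. \<phi> (x n) t)" by (rule convergent_Cauchy)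
  have "Cauchy x"
  proof (rule CauchyI)
    fix e :: real assume "0 < e"
    then have "0 < k * e" using k by simp
    then obtain M where M: "\<And>m n. m \<ge> M \<Longrightarrow> n \<ge> M \<Longrightarrow> norm (\<phi> (x m) t - \<phi> (x n) t) < k * e"
      using CauchyD[OF C] by blast
    have "norm (x m - x n) < e" if "m \<ge> M" "n \<ge> M" for m n
    proof -
      have "k * norm (x m - x n) \<le> norm (\<phi> (x m) t - \<phi> (x n) t)"
        using dist_le[of m n] dist_le[of n m] by (cases "m \<le> n") (auto simp: norm_minus_commute)
      also have "\<dots> < k * e" using M that by blast
      finally show ?thesis using k by simp
    qed
    then show "\<exists>M. \<forall>m\<ge>M. \<forall>n\<ge>M. norm (x m - x n) < e" by blast
  qed
  then obtain u where u: "x \<longlonglongrightarrow> u" using Cauchy_convergent_iff convergent_def by blast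
  have u_norm: "norm u \<le> 1"
    by (rule LIMSEQ_le_const2[OF tendsto_norm[OF u]]) (use x_norm in auto)
  have diff: "\<bar>\<phi> y s - \<phi> z s\<bar> \<le> norm (y - z)" for y z s
    using bd[of "y - z" s] linear_diff[OF lin[of s]] by simp
  have lim\<phi>: "(\<lambda>n. \<phi> (x n) s) \<longlonglongrightarrow> \<phi> u s" for s
  proof (rule LIM_zero_cancel, rule Lim_null_comparison)
    show "(\<lambda>n. norm (x n - u)) \<longlonglongrightarrow> 0" using u LIM_zero tendsto_norm_zero by blast
  qed (use diff in auto)
  show thesis
  proof (rule that[OF u_norm])
    show "k * norm (u - x0) \<le> \<phi> u t - \<phi> x0 t"
    proof (rule LIMSEQ_le)
      show "(\<lambda>n. k * norm (x n - x0)) \<longlonglongrightarrow> k * norm (u - x0)" by (intro tendsto_intros u)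
      show "(\<lambda>n. \<phi> (x n) t - \<phi> x0 t) \<longlonglongrightarrow> \<phi> u t - \<phi> x0 t" by (intro tendsto_intros lim\<phi>)
      show "\<exists>N. \<forall>n\<ge>N. k * norm (x n - x0) \<le> \<phi> (x n) t - \<phi> x0 t"
        using dist_le[of 0] start by auto
    qed
    show "a < \<phi> x0 t" using t[of 0] start V0 by auto
    fix \<delta> :: real assume \<delta>: "0 < \<delta>"
    \<comment> \<open>Replacing \<open>x (Suc n)\<close> by its limit \<open>u\<close> costs one
      distance for \<phi>, which is 1-Lipschitz, and \<open>k\<close> distances for the
      penalty.\<close>
    have "(\<lambda>n. (1 + k) * norm (x (Suc n) - u) + inverse (Suc n)) \<longlonglongrightarrow> (1 + k) * norm (u - u) + 0"
      using LIMSEQ_inverse_real_of_nat u by (intro tendsto_intros) (auto intro: LIMSEQ_Suc)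
    then have "eventually (\<lambda>n. (1 + k) * norm (x (Suc n) - u) + inverse (Suc n) < \<delta>) sequentially"
      using \<delta> by (intro order_tendstoD) auto
    then obtain n where n: "(1 + k) * norm (x (Suc n) - u) + inverse (Suc n) < \<delta>"
      using eventually_sequentially by auto
    have "\<phi> y s \<le> \<phi> u s + k * norm (y - u) + \<delta>" if "s \<in> V (Suc n)" "norm y \<le> 1" for s y
    proof -
      have "\<phi> (x (Suc n)) s \<le> \<phi> u s + norm (x (Suc n) - u)" using diff[of "x (Suc n)" s u] by simp
      moreover have "k * norm (y - x (Suc n)) \<le> k * (norm (y - u) + norm (x (Suc n) - u))"
        using k norm_triangle_ineq4[of "y - u" "x (Suc n) - u"] by (intro mult_left_mono) auto
      ultimately show ?thesis using maxi[OF that] n by (simp add: algebra_simps)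
    qed
    then show "\<exists>V. open V \<and> closed V \<and> t \<in> V \<and>
       (\<forall>s\<in>V. \<forall>y. norm y \<le> 1 \<longrightarrow> \<phi> y s \<le> \<phi> u s + k * norm (y - u) + \<delta>)"
      using openV closedV t by (intro exI[of _ "V (Suc n)"]) simp
  qed
qed

section \<open>From approximate extremality to a supporting linear perturbation\<close>

text \<open>The errors in Ekeland's condition are collected in one continuous function
  \<open>d\<close>, the supremum in C(L, R) of \<phi> at \<open>y\<close> minus \<phi> at
  \<open>u\<close> minus \<open>k * norm (y - u)\<close> over the unit ball. On the ball translated
  by \<open>- u\<close>, \<phi> minus \<open>d\<close> then lies below \<open>k\<close> times the
  norm, and Hahn-Banach puts \<theta> in between.\<close>

lemma Brondsted_Rockafellar:
  fixes \<phi> :: "'x::banach \<Rightarrow> 'l::t2_space \<Rightarrow> real"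
  assumes L: "compact (UNIV :: 'l set)" "extremally_disconnected TYPE('l)"
    and cont: "\<And>x. continuous_on UNIV (\<phi> x)"
    and lin: "\<And>t. linear (\<lambda>x. \<phi> x t)"
    and bd: "\<And>x t. \<bar>\<phi> x t\<bar> \<le> norm x"
    and k: "0 < k" and x0: "norm x0 \<le> 1" and t0: "a < \<phi> x0 t0"
  obtains u t \<theta> d where "norm u \<le> 1" "k * norm (u - x0) \<le> \<phi> u t - \<phi> x0 t" "a < \<phi> x0 t"
    "\<And>x. continuous_on UNIV (\<theta> x)" "\<And>t. linear (\<lambda>x. \<theta> x t)"
    "\<And>x t. \<bar>\<theta> x t\<bar> \<le> k * norm x"
    "continuous_on UNIV d" "\<And>s. 0 \<le> d s" "d t = 0"
    "\<And>y s. norm y \<le> 1 \<Longrightarrow> \<phi> y s - \<theta> y s \<le> \<phi> u s - \<theta> u s + d s"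
proof -
  obtain u t where u: "norm u \<le> 1" "k * norm (u - x0) \<le> \<phi> u t - \<phi> x0 t" "a < \<phi> x0 t"
    and near: "\<And>\<delta>. 0 < \<delta> \<Longrightarrow> \<exists>V. open V \<and> closed V \<and> t \<in> V \<and>
       (\<forall>s\<in>V. \<forall>y. norm y \<le> 1 \<longrightarrow> \<phi> y s \<le> \<phi> u s + k * norm (y - u) + \<delta>)"
    using Ekeland_principle[OF L cont lin bd k x0 t0] by metis
  define A where "A = (\<lambda>y s. \<phi> u s + k * norm (y - u) - \<phi> y s) ` cball 0 1"
  define d where "d s = - order_inf A s" for s
  have A_ne: "A \<noteq> {}" by (simp add: A_def)
  have A_cont: "continuous_on UNIV f" if "f \<in> A" for f
    using that unfolding A_def by (auto intro!: continuous_intros cont)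
  have bd1: "\<bar>\<phi> y s\<bar> \<le> 1" if "norm y \<le> 1" for y s using bd that order.trans by blast
  have A_low: "- 2 \<le> f s" if "f \<in> A" for f s
  proof -
    obtain y where y: "norm y \<le> 1" "f = (\<lambda>s. \<phi> u s + k * norm (y - u) - \<phi> y s)"
      using \<open>f \<in> A\<close> unfolding A_def by auto
    have "0 \<le> k * norm (y - u)" using k by simp
    then show ?thesis unfolding y(2) using bd1[OF y(1), of s] bd1[OF u(1), of s] by simp
  qed
  note A_inf = order_inf_properties[OF L(2) A_ne, where m = "- 2"]
  have contd: "continuous_on UNIV d"
    unfolding d_def by (intro continuous_intros A_inf(1)) (use A_cont A_low in auto)
  have d_ge: "\<phi> y s - (\<phi> u s + k * norm (y - u)) \<le> d s" if "norm y \<le> 1" for y s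
  proof -
    have "(\<lambda>s. \<phi> u s + k * norm (y - u) - \<phi> y s) \<in> A" using that by (auto simp: A_def)
    then have "order_inf A s \<le> \<phi> u s + k * norm (y - u) - \<phi> y s"
      by (rule A_inf(2)[rotated 2]) (use A_cont A_low in auto)
    then show ?thesis unfolding d_def by simp
  qed
  have d_nonneg: "0 \<le> d s" for s using d_ge[OF u(1), of s] by simp
  have "d t \<le> \<delta>" if \<delta>: "0 < \<delta>" for \<delta>
  proof -
    obtain V where V: "open V" "closed V" "t \<in> V"
      "\<And>s y. s \<in> V \<Longrightarrow> norm y \<le> 1 \<Longrightarrow> \<phi> y s \<le> \<phi> u s + k * norm (y - u) + \<delta>"
      using near[OF \<delta>] by blast
    \<comment> \<open>Since \<open>V\<close> is clopen, this two-valued function is continuous. It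
      is a lower bound of \<open>A\<close>, so the infimum at \<open>t\<close> is at least -
      \<delta>.\<close>
    define h where "h s = (if s \<in> V then - \<delta> else - 2)" for s :: 'l
    have "continuous_on (V \<union> - V) h"
      unfolding h_def by (rule continuous_on_cases) (use V in \<open>auto simp: closed_Compl\<close>)
    then have "continuous_on UNIV h" by simp
    moreover have "h s \<le> f s" if "f \<in> A" for f s
      using V(4)[of s] A_low[OF that, of s] that unfolding A_def h_def by force
    ultimately have "h t \<le> order_inf A t" using A_cont A_low by (intro A_inf(3)) auto
    then show ?thesis using V(3) by (simp add: h_def d_def)
  qed
  then have d_t: "d t = 0" using d_nonneg[of t] by (meson antisym dense_ge)
  define C where "C = (\<lambda>y. y - u) ` cball 0 1"
  define g where "g z s = \<phi> z s - d s" for z s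
  have C: "convex C" "C \<noteq> {}" unfolding C_def by (simp_all add: convex_translation_subtract)
  have g_cont: "continuous_on UNIV (g z)" for z unfolding g_def by (intro continuous_intros cont contd)
  have g_le: "g z s \<le> k * norm z" if "z \<in> C" for z s
    using that d_ge[of "z + u" s] linear_add[OF lin[of s], of z u] unfolding C_def g_def by auto
  \<comment> \<open>The function \<open>d\<close> is subtracted once on each side because the
    weights add up to 1.\<close>
  have g_affine: "a * g z s + b * g w s \<le> g (a *\<^sub>R z + b *\<^sub>R w) s" if "a + b = 1" for z w a b s
  proof -
    have "a * d s + b * d s = d s" using that by (simp add: distrib_right[symmetric])
    then show ?thesis unfolding g_def
      by (simp add: linear_add[OF lin] linear_scale[OF lin] algebra_simps)
  qed
  obtain \<theta> where \<theta>: "\<And>x. continuous_on UNIV (\<theta> x)" "\<And>t. linear (\<lambda>x. \<theta> x t)"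
    "\<And>x t. \<bar>\<theta> x t\<bar> \<le> k * norm x" "\<And>z t. z \<in> C \<Longrightarrow> g z t \<le> \<theta> z t"
    by (rule Hahn_Banach_sandwich[OF L(2) less_imp_le[OF k] C, where g = g]) (use g_cont g_le g_affine in auto)
  have "\<phi> y s - \<theta> y s \<le> \<phi> u s - \<theta> u s + d s" if "norm y \<le> 1" for y s
  proof -
    have "y - u \<in> C" using that by (auto simp: C_def)
    from \<theta>(4)[OF this, of s] show ?thesis
      unfolding g_def by (simp add: linear_diff[OF lin] linear_diff[OF \<theta>(2)])
  qed
  then show thesis by (rule that[OF u \<theta>(1-3) contd d_nonneg d_t])
qed

section \<open>Construction of the norm-attaining operator\<close>

text \<open>The proof for real and complex scalars at once: \<open>re\<close> is the real part on \<open>'f\<close>, and \<open>extend\<close>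
  recovers an \<open>'f\<close>-linear operator from its real part.\<close>

lemma BPB_property_generic:
  fixes sX :: "'f::real_normed_field \<Rightarrow> 'x::banach \<Rightarrow> 'x"
    and sY :: "'f \<Rightarrow> ('l::t2_space \<Rightarrow>\<^sub>C 'f) \<Rightarrow> ('l \<Rightarrow>\<^sub>C 'f)"
    and re :: "'f \<Rightarrow> real"
  assumes L: "compact (UNIV :: 'l set)" "extremally_disconnected TYPE('l)"
    and re: "bounded_linear re" "\<And>z. \<bar>re z\<bar> \<le> norm z" "\<And>r. re (of_real r) = r"
    and rotate: "\<And>z :: 'f. \<exists>c. norm c = 1 \<and> c * z = of_real (norm z)"
    and sX: "\<And>c x. norm (sX c x) = norm c * norm x"
    and sY: "\<And>c f t. apply_bcontfun (sY c f) t = c * f t"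
    and extend: "\<And>\<theta> :: 'x \<Rightarrow> 'l \<Rightarrow> real. (\<And>x. continuous_on UNIV (\<theta> x)) \<Longrightarrow>
      (\<And>t. linear (\<lambda>x. \<theta> x t)) \<Longrightarrow>
      \<exists>\<Theta> :: 'x \<Rightarrow> 'l \<Rightarrow> 'f. (\<forall>x. continuous_on UNIV (\<Theta> x)) \<and> (\<forall>t. linear (\<lambda>x. \<Theta> x t)) \<and>
        (\<forall>c x t. \<Theta> (sX c x) t = c * \<Theta> x t) \<and> (\<forall>x t. re (\<Theta> x t) = \<theta> x t)"
  shows "BPB_property sX sY (\<lambda>\<epsilon>. \<epsilon>\<^sup>2 / 32)"
  unfolding BPB_property_def
proof (intro allI impI ballI, elim conjE)
  fix \<epsilon> :: real and T :: "'x \<Rightarrow>\<^sub>L ('l \<Rightarrow>\<^sub>C 'f)" and x0 :: 'x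
  assume \<epsilon>: "0 < \<epsilon>" "\<epsilon> < 1" and T: "T \<in> bounded_operators sX sY" "norm T = 1"
    and x0: "norm x0 = 1" and big: "1 - \<epsilon>\<^sup>2 / 32 < norm (T x0)"
  have T_hom: "T (sX c x) t = c * T x t" for c x t
    using T(1) sY by (simp add: bounded_operators_def)
  have T_bd: "norm (T x t) \<le> norm x" for x t
    using norm_bounded[of "T x" t] norm_blinfun[of T x] T(2) by simp
  have "\<exists>t. 1 - \<epsilon>\<^sup>2 / 32 < norm (T x0 t)"
  proof (rule ccontr)
    assume "\<not> ?thesis"
    then have "norm (T x0) \<le> 1 - \<epsilon>\<^sup>2 / 32" by (intro norm_bound) (auto simp: not_less)
    then show False using big by simp
  qed
  then obtain t0 where t0: "1 - \<epsilon>\<^sup>2 / 32 < norm (T x0 t0)" by blast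
  obtain c where c: "norm c = 1" "c * T x0 t0 = of_real (norm (T x0 t0))"
    using rotate[of "T x0 t0"] by blast
  then have c0: "c \<noteq> 0" by auto
  define \<phi> where "\<phi> x t = re (c * T x t)" for x t
  have \<phi>_cont: "continuous_on UNIV (\<phi> x)" for x
    unfolding \<phi>_def by (intro bounded_linear.continuous_on[OF re(1)] continuous_intros continuous_on_apply_bcontfun)
  have \<phi>_lin: "linear (\<lambda>x. \<phi> x t)" for t
    by (rule linearI) (simp_all add: \<phi>_def blinfun.add_right blinfun.scaleR_right distrib_left
        linear_add[OF bounded_linear.linear[OF re(1)]] linear_scale[OF bounded_linear.linear[OF re(1)]])
  have \<phi>_bd: "\<bar>\<phi> x t\<bar> \<le> norm x" for x t
    unfolding \<phi>_def using re(2)[of "c * T x t"] T_bd[of x t] c(1) by (simp add: norm_mult)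
  have \<phi>_t0: "1 - \<epsilon>\<^sup>2 / 32 < \<phi> x0 t0" unfolding \<phi>_def c(2) re(3) by (rule t0)
  \<comment> \<open>This choice gives \<open>norm (u - x0)\<close> < (\<epsilon>^2/32)/k =
    \<epsilon>/8, while the perturbation \<Theta> costs only \<epsilon>/4 in operator norm.\<close>
  define k where "k = \<epsilon> / 4"
  have k: "0 < k" using \<epsilon> by (simp add: k_def)
  have "norm x0 \<le> 1" using x0 by simp
  from Brondsted_Rockafellar[OF L \<phi>_cont \<phi>_lin \<phi>_bd k this \<phi>_t0]
  obtain u t \<theta> d where u: "norm u \<le> 1" "k * norm (u - x0) \<le> \<phi> u t - \<phi> x0 t" "1 - \<epsilon>\<^sup>2 / 32 < \<phi> x0 t"
    and \<theta>: "\<And>x. continuous_on UNIV (\<theta> x)" "\<And>t. linear (\<lambda>x. \<theta> x t)" "\<And>x t. \<bar>\<theta> x t\<bar> \<le> k * norm x"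
    and d: "continuous_on UNIV d" "\<And>s. 0 \<le> d s" "d t = 0"
    and max: "\<And>y s. norm y \<le> 1 \<Longrightarrow> \<phi> y s - \<theta> y s \<le> \<phi> u s - \<theta> u s + d s" by blast
  obtain \<Theta> :: "'x \<Rightarrow> 'l \<Rightarrow> 'f" where \<Theta>: "\<And>x. continuous_on UNIV (\<Theta> x)" "\<And>t. linear (\<lambda>x. \<Theta> x t)"
    "\<And>c x t. \<Theta> (sX c x) t = c * \<Theta> x t" and re\<Theta>: "\<And>x t. re (\<Theta> x t) = \<theta> x t"
    using extend[OF \<theta>(1,2)] by blast
  have \<Theta>_bd: "norm (\<Theta> x s) \<le> k * norm x" for x s
  proof -
    \<comment> \<open>Rotating \<open>x\<close> by a unimodular scalar makes the value of \<Theta>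
      real and nonnegative, so the bound on its real part bounds its modulus. The same device is
      used for \<psi> below.\<close>
    obtain b where b: "norm b = 1" "b * \<Theta> x s = of_real (norm (\<Theta> x s))" using rotate by blast
    have "norm (\<Theta> x s) = \<theta> (sX b x) s" using re(3) re\<Theta>[of "sX b x" s] \<Theta>(3) b(2) by simp
    also have "\<dots> \<le> k * norm x" using \<theta>(3)[of "sX b x" s] sX[of b x] b(1) by simp
    finally show ?thesis .
  qed
  define \<psi> where "\<psi> x s = c * T x s - \<Theta> x s" for x s
  define D where "D s = \<phi> u s - \<theta> u s + d s" for s
  have re_diff: "re (x - y) = re x - re y" for x y
    by (rule linear_diff[OF bounded_linear.linear[OF re(1)]])
  have re\<psi>: "re (\<psi> x s) = \<phi> x s - \<theta> x s" for x s
    unfolding \<psi>_def \<phi>_def re_diff re\<Theta> ..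
  have \<psi>_hom: "\<psi> (sX b x) s = b * \<psi> x s" for b x s
    unfolding \<psi>_def by (simp add: T_hom \<Theta>(3) algebra_simps)
  have \<psi>_lin: "linear (\<lambda>x. \<psi> x s)" for s
    by (rule linearI) (simp_all add: \<psi>_def blinfun.add_right blinfun.scaleR_right
        linear_add[OF \<Theta>(2)] linear_scale[OF \<Theta>(2)] algebra_simps)
  have \<psi>_cont: "continuous_on UNIV (\<psi> x)" for x
    unfolding \<psi>_def by (intro continuous_intros continuous_on_apply_bcontfun \<Theta>(1))
  have \<psi>_le1: "norm (\<psi> y s) \<le> D s" if "norm y \<le> 1" for y s
  proof -
    obtain b where b: "norm b = 1" "b * \<psi> y s = of_real (norm (\<psi> y s))" using rotate by blast
    have "norm (\<psi> y s) = re (\<psi> (sX b y) s)" using re(3) \<psi>_hom b(2) by simp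
    also have "\<dots> \<le> D s" unfolding re\<psi> D_def by (rule max) (use sX b that in simp)
    finally show ?thesis .
  qed
  have \<psi>_le: "norm (\<psi> x s) \<le> D s * norm x" for x s
  proof (cases "x = 0")
    case True
    then show ?thesis using linear_0[OF \<psi>_lin[of s]] by simp
  next
    case False
    have "norm (\<psi> (inverse (norm x) *\<^sub>R x) s) \<le> D s" by (rule \<psi>_le1) (use False in simp)
    then show ?thesis using False linear_scale[OF \<psi>_lin[of s]] by (simp add: field_simps)
  qed
  have u_close: "norm (u - x0) < \<epsilon>"
  proof -
    have "k * norm (u - x0) < \<epsilon>\<^sup>2 / 32" using u \<phi>_bd[of u t] by linarith
    then have "norm (u - x0) < \<epsilon> / 8" using \<epsilon> by (simp add: k_def power2_eq_square field_simps)
    then show ?thesis using \<epsilon> by simp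
  qed
  have D_cont: "continuous_on UNIV D" unfolding D_def by (intro continuous_intros \<phi>_cont \<theta>(1) d(1))
  have \<epsilon>2: "\<epsilon>\<^sup>2 / 32 \<le> \<epsilon> / 32" using \<epsilon> by (simp add: power2_eq_square)
  have \<phi>_ut: "1 - \<epsilon>\<^sup>2 / 32 < \<phi> u t"
    using u(2,3) k by (smt (verit) norm_ge_zero mult_nonneg_nonneg)
  have "open ({s. d s < \<epsilon> / 16} \<inter> {s. 1 - \<epsilon>\<^sup>2 / 32 < \<phi> u s})"
    by (intro open_Int open_Collect_less continuous_intros d(1) \<phi>_cont)
  then obtain V where V: "open V" "closed V" "t \<in> V"
    "V \<subseteq> {s. d s < \<epsilon> / 16} \<inter> {s. 1 - \<epsilon>\<^sup>2 / 32 < \<phi> u s}"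
    by (rule clopen_neighbourhood[OF L, of _ t]) (use d(3) \<epsilon> \<phi>_ut in auto)
  \<comment> \<open>The bound is \<epsilon>/4 for \<theta> plus \<epsilon>/16 for \<open>d\<close>;
    from below, the defect of \<phi> at \<open>u\<close>, at most \<epsilon>/32, replaces the
    contribution of \<open>d\<close>.\<close>
  have D_close: "\<bar>1 - D s\<bar> \<le> 5 * \<epsilon> / 16" if "s \<in> V" for s
  proof -
    have "\<bar>\<theta> u s\<bar> \<le> k" using \<theta>(3)[of u s] u(1) k by (meson mult_left_le less_imp_le order.trans)
    moreover have "d s < \<epsilon> / 16" "1 - \<epsilon>\<^sup>2 / 32 < \<phi> u s" using V(4) that by auto
    moreover have "\<phi> u s \<le> 1" using \<phi>_bd[of u s] u(1) by linarith
    ultimately show ?thesis using d(2)[of s] \<epsilon>2 unfolding D_def k_def by linarith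
  qed
  have D_pos: "0 < D s" if "s \<in> V" for s using D_close[OF that] \<epsilon> by linarith
  \<comment> \<open>On \<open>V\<close> the bound \<open>D\<close> normalises \<psi>, and dividing
    by \<open>c\<close> undoes the initial rotation. Outside \<open>V\<close> the operator
    \<open>T\<close> is kept; continuity survives because \<open>V\<close> is clopen.\<close>
  define F where "F x s = (if s \<in> V then \<psi> x s / (c * of_real (D s)) else T x s)" for x s
  have F_bd: "norm (F x s) \<le> norm x" for x s
    using \<psi>_le[of x s] D_pos[of s] T_bd[of x s] c(1)
    by (auto simp: F_def norm_divide norm_mult field_simps)
  have F_cont: "continuous_on UNIV (F x)" for x
  proof -
    have "continuous_on (V \<union> - V) (F x)"
      unfolding F_def
    proof (rule continuous_on_cases)
      show "continuous_on V (\<lambda>s. \<psi> x s / (c * of_real (D s)))"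
        using D_pos c0 by (intro continuous_intros continuous_on_subset[OF \<psi>_cont] continuous_on_subset[OF D_cont]) force+
    qed (use V in \<open>auto simp: closed_Compl\<close>)
    then show ?thesis by simp
  qed
  have F_bcontfun: "F x \<in> bcontfun" for x by (rule bcontfun_normI[OF F_cont F_bd])
  define S where "S = Blinfun (\<lambda>x. Bcontfun (F x))"
  have app: "apply_bcontfun (Bcontfun (F x)) = F x" for x by (simp add: Bcontfun_inverse F_bcontfun)
  have "bounded_linear (\<lambda>x. Bcontfun (F x))"
  proof (rule bounded_linear_intro[where K = 1])
    show "Bcontfun (F (x + y)) = Bcontfun (F x) + Bcontfun (F y)" for x y
      by (rule bcontfun_eqI) (simp add: app F_def linear_add[OF \<psi>_lin] blinfun.add_right add_divide_distrib)
    show "Bcontfun (F (r *\<^sub>R x)) = r *\<^sub>R Bcontfun (F x)" for r x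
      by (rule bcontfun_eqI) (simp add: app F_def linear_scale[OF \<psi>_lin] blinfun.scaleR_right scaleR_conv_of_real)
    show "norm (Bcontfun (F x)) \<le> norm x * 1" for x
      by (rule norm_bound) (simp add: app F_bd)
  qed
  then have S_app: "S x s = F x s" for x s
    by (simp add: S_def bounded_linear_Blinfun_apply app)
  have S_op: "S \<in> bounded_operators sX sY"
    unfolding bounded_operators_def
    by (auto intro!: bcontfun_eqI simp: S_app sY F_def \<psi>_hom T_hom)
  have S_le: "norm S \<le> 1"
    by (rule norm_blinfun_bound) (auto intro!: norm_bound simp: S_app F_bd)
  have Su_ge: "1 \<le> norm (S u)"
  proof -
    \<comment> \<open>At \<open>t\<close> the error \<open>d\<close> vanishes, so the normalising
      factor is attained at \<open>u\<close>.\<close>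
    have "re (\<psi> u t) = D t" unfolding re\<psi> D_def d(3) by simp
    then have "D t \<le> norm (\<psi> u t)" using re(2)[of "\<psi> u t"] by simp
    then have "1 \<le> norm (S u t)"
      using D_pos[OF V(3)] V(3) c(1) by (simp add: S_app F_def norm_divide norm_mult)
    then show ?thesis using norm_bounded[of "S u" t] by simp
  qed
  have Su_le: "norm (S u) \<le> norm S * norm u" by (rule norm_blinfun)
  \<comment> \<open>Both factors are at most 1 and their product is at least 1, which forces all
    three norms to be 1.\<close>
  have "norm S * norm u \<le> norm S" "norm S * norm u \<le> norm u"
    using u(1) S_le by (simp_all add: mult_left_le mult_right_le_one_le mult_left_le_one_le)
  then have one: "norm S = 1" "norm u = 1" "norm (S u) = 1"
    using Su_ge Su_le S_le u(1) by linarith+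
  have FT: "norm (F x s - T x s) \<le> 9 * \<epsilon> / 16 * norm x" for x s
  proof (cases "s \<in> V")
    case True
    \<comment> \<open>On \<open>V\<close>, \<open>c * F x s\<close> is \<psi>/D and
      \<open>c * T x s\<close> is \<psi> + \<Theta>. The two terms contribute 5\<epsilon>/16 and
      \<epsilon>/4, together 9\<epsilon>/16.\<close>
    have eq: "c * (F x s - T x s) = of_real ((1 - D s) / D s) * \<psi> x s - \<Theta> x s"
    proof -
      have "D s \<noteq> 0" using D_pos[OF True] by simp
      then show ?thesis using True c0 unfolding F_def \<psi>_def by (simp add: field_simps)
    qed
    have "norm (F x s - T x s) = norm (c * (F x s - T x s))" using c(1) by (simp add: norm_mult)
    also have "\<dots> \<le> norm (of_real ((1 - D s) / D s) * \<psi> x s) + norm (\<Theta> x s)"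
      unfolding eq by (rule norm_triangle_ineq4)
    also have "norm (of_real ((1 - D s) / D s) * \<psi> x s) = \<bar>1 - D s\<bar> / D s * norm (\<psi> x s)"
      using D_pos[OF True] by (simp add: norm_mult del: of_real_divide of_real_diff)
    also have "\<bar>1 - D s\<bar> / D s * norm (\<psi> x s) \<le> \<bar>1 - D s\<bar> / D s * (D s * norm x)"
      using \<psi>_le D_pos[OF True] by (intro mult_left_mono) auto
    also have "\<dots> = \<bar>1 - D s\<bar> * norm x" using D_pos[OF True] by simp
    also have "\<bar>1 - D s\<bar> * norm x \<le> 5 * \<epsilon> / 16 * norm x" using D_close[OF True] by (intro mult_right_mono) auto
    also have "norm (\<Theta> x s) \<le> \<epsilon> / 4 * norm x" using \<Theta>_bd unfolding k_def .
    finally show ?thesis by (simp add: field_simps)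
  qed (use \<epsilon> in \<open>simp add: F_def\<close>)
  have "norm (S - T) \<le> 9 * \<epsilon> / 16"
  proof (rule norm_blinfun_bound)
    show "norm ((S - T) x) \<le> 9 * \<epsilon> / 16 * norm x" for x
      by (rule norm_bound) (use FT in \<open>simp add: blinfun.diff_left S_app\<close>)
  qed (use \<epsilon> in simp)
  then have "norm (S - T) < \<epsilon>" using \<epsilon> by simp
  then show "\<exists>S \<in> bounded_operators sX sY. \<exists>u0. norm S = 1 \<and> norm u0 = 1 \<and>
      norm (blinfun_apply S u0) = 1 \<and> norm (u0 - x0) < \<epsilon> \<and> norm (S - T) < \<epsilon>"
    using S_op one u_close by blast
qed

section \<open>The real and the complex scalar field\<close>

theorem theorem3:
  assumes "compact (UNIV :: 'l::t2_space set)"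
    and "extremally_disconnected TYPE('l)"
    and "less_card_infty (dens TYPE('x::banach)) (baire_number TYPE('l))"
  shows "BPB_property ((*\<^sub>R) :: real \<Rightarrow> 'x \<Rightarrow> 'x)
           ((*\<^sub>R) :: real \<Rightarrow> ('l \<Rightarrow>\<^sub>C real) \<Rightarrow> ('l \<Rightarrow>\<^sub>C real)) (\<lambda>\<epsilon>. \<epsilon>\<^sup>2 / 32)
       \<and> (\<forall>scaleC :: complex \<Rightarrow> 'x \<Rightarrow> 'x. complex_banach scaleC \<longrightarrow>
           BPB_property scaleC
             (scaleC_bcontfun :: complex \<Rightarrow> ('l \<Rightarrow>\<^sub>C complex) \<Rightarrow> ('l \<Rightarrow>\<^sub>C complex)) (\<lambda>\<epsilon>. \<epsilon>\<^sup>2 / 32))"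
proof (intro conjI allI impI)
  show "BPB_property ((*\<^sub>R) :: real \<Rightarrow> 'x \<Rightarrow> 'x)
    ((*\<^sub>R) :: real \<Rightarrow> ('l \<Rightarrow>\<^sub>C real) \<Rightarrow> ('l \<Rightarrow>\<^sub>C real)) (\<lambda>\<epsilon>. \<epsilon>\<^sup>2 / 32)"
  proof (rule BPB_property_generic[OF assms(1,2), where re = "\<lambda>x. x"])
    show "\<exists>c. norm c = 1 \<and> c * z = of_real (norm z)" for z :: real
      by (intro exI[of _ "if 0 \<le> z then 1 else - 1"]) auto
    show "\<exists>\<Theta> :: 'x \<Rightarrow> 'l \<Rightarrow> real. (\<forall>x. continuous_on UNIV (\<Theta> x)) \<and> (\<forall>t. linear (\<lambda>x. \<Theta> x t)) \<and>
        (\<forall>c x t. \<Theta> (c *\<^sub>R x) t = c * \<Theta> x t) \<and> (\<forall>x t. \<Theta> x t = \<theta> x t)"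
      if "\<And>x. continuous_on UNIV (\<theta> x)" "\<And>t. linear (\<lambda>x. \<theta> x t)" for \<theta> :: "'x \<Rightarrow> 'l \<Rightarrow> real"
      using that linear_scale[OF that(2)] by (intro exI[of _ \<theta>]) simp
  qed (simp_all add: bounded_linear_ident)
next
  fix scaleC :: "complex \<Rightarrow> 'x \<Rightarrow> 'x"
  assume "complex_banach scaleC"
  then interpret complex_banach scaleC .
  show "BPB_property scaleC
    (scaleC_bcontfun :: complex \<Rightarrow> ('l \<Rightarrow>\<^sub>C complex) \<Rightarrow> ('l \<Rightarrow>\<^sub>C complex)) (\<lambda>\<epsilon>. \<epsilon>\<^sup>2 / 32)"
  proof (rule BPB_property_generic[OF assms(1,2), where re = Re])
    show "\<exists>c. norm c = 1 \<and> c * z = of_real (norm z)" for z :: complex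
    proof (cases "z = 0")
      case False
      then have "cnj z / of_real (norm z) * z = of_real (norm z)"
        by (simp add: field_simps complex_norm_square[symmetric] power2_eq_square)
      moreover have "norm (cnj z / of_real (norm z)) = 1" using False by (simp add: norm_divide)
      ultimately show ?thesis by blast
    qed (auto intro: exI[of _ 1])
    show "\<exists>\<Theta> :: 'x \<Rightarrow> 'l \<Rightarrow> complex. (\<forall>x. continuous_on UNIV (\<Theta> x)) \<and> (\<forall>t. linear (\<lambda>x. \<Theta> x t)) \<and>
        (\<forall>c x t. \<Theta> (scaleC c x) t = c * \<Theta> x t) \<and> (\<forall>x t. Re (\<Theta> x t) = \<theta> x t)"
      if \<theta>: "\<And>x. continuous_on UNIV (\<theta> x)" "\<And>t. linear (\<lambda>x. \<theta> x t)" for \<theta> :: "'x \<Rightarrow> 'l \<Rightarrow> real"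
    \<comment> \<open>A complex-linear functional f satisfies Im f(x) = - Re f(ix), so its real part
      determines it by this formula.\<close>
    proof (intro exI[of _ "\<lambda>x t. Complex (\<theta> x t) (- \<theta> (scaleC \<i> x) t)"] conjI allI)
      note add = linear_add[OF \<theta>(2)] and scale = linear_scale[OF \<theta>(2)]
      show "continuous_on UNIV (\<lambda>t. Complex (\<theta> x t) (- \<theta> (scaleC \<i> x) t))" for x
        unfolding Complex_eq by (intro continuous_intros \<theta>(1))
      have rot: "scaleC \<i> (r *\<^sub>R x) = r *\<^sub>R scaleC \<i> x" for r x
        by (simp add: scaleC_of_real[symmetric] mult.commute)
      show "linear (\<lambda>x. Complex (\<theta> x t) (- \<theta> (scaleC \<i> x) t))" for t
        by (rule linearI) (simp_all add: scale_right_distrib rot add scale complex_eq_iff)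
      \<comment> \<open>Multiplication by \<open>c\<close> becomes a real combination of
        \<open>x\<close> and its multiple by \<i>, to which real linearity of \<theta>
        applies.\<close>
      have split: "scaleC c x = Re c *\<^sub>R x + Im c *\<^sub>R scaleC \<i> x" for c x
        by (subst complex_eq[of c]) (simp add: scale_left_distrib scaleC_of_real[symmetric] mult.commute)
      have neg: "scaleC \<i> (scaleC \<i> x) = (- 1) *\<^sub>R x" for x by simp
      show "Complex (\<theta> (scaleC c x) t) (- \<theta> (scaleC \<i> (scaleC c x)) t) =
          c * Complex (\<theta> x t) (- \<theta> (scaleC \<i> x) t)" for c x t
        unfolding split[of c x] scale_right_distrib rot neg
        by (simp add: add scale complex_eq_iff linear_neg[OF \<theta>(2)] linear_diff[OF \<theta>(2)] del: scale_scale)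
    qed simp
  qed (simp_all add: bounded_linear_Re abs_Re_le_cmod norm_scaleC)
qed

end
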